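(* Let $G$ and $H$ be connected graphs and $k\ge 1$ an integer such that $G$ is $k$-connected (i.e. $\kappa(G)\ge k$) and $|V(G)|\ge 2k-1$. Then \[\mathrm{sn}(G\square H)\geq \min\left(k|V(H)|,\ |V(G)|\lambda(H),\ (|V(G)|-2k+2)\lambda(H)+2\lambda(G)\right).\]
   Context: Graphs are finite, multiple edges allowed, no loops. $\kappa(G)$ is the vertex-connectivity (minimum number of vertices whose removal disconnects $G$ or leaves a single vertex) and $\lambda(G)$ the edge-connectivity (minimum number of edges, counted with multiplicity, whose removal disconnects $G$ or leaves a single vertex). $G\square H$ is the Cartesian product: vertex set $V(G)\times V(H)$, with $(u_1,v_1)$ joined to $(u_2,v_2)$ by $e$ edges iff either $u_1=u_2$ and $v_1,v_2$ are joined by $e$ edges in $H$, or $v_1=v_2$ and $u_1,u_2$ are joined by $e$ edges in $G$. Scramble number: a scramble is a finite collection of nonempty vertex sets (eggs) each inducing a connected subgraph; a hitting set meets every egg and $h$ is the minimum hitting set size; an egg-cut is $A\subseteq V$ with some egg in $A$ and some egg in $A^C$, of size $|E(A,A^C)|$ (number of edges between $A$ and $A^C$), and $e$ is the minimum egg-cut size ($+\infty$ if none); the order is $\min(h,e)$, and $\mathrm{sn}$ is the maximum order of a scramble. *)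

theory Defs
  imports Main "HOL-Library.Multiset" "HOL-Library.Extended_Nat"
begin

text \<open>An edge is the two-element set of its end points; parallel edges are repeated
  elements of the multiset \<open>edges G\<close>, so \<open>u\<close> and \<open>v\<close> are joined by
  \<open>count (edges G) {u, v}\<close> edges.\<close>

record 'a mgraph =
  verts :: "'a set"
  edges :: "'a set multiset"

definition multigraph :: "'a mgraph \<Rightarrow> bool" where
  "multigraph G \<longleftrightarrow> finite (verts G) \<and> (\<forall>e \<in># edges G. e \<subseteq> verts G \<and> card e = 2)"

definition adjacency :: "'a mgraph \<Rightarrow> ('a \<times> 'a) set" where
  "adjacency G = {(u, v). {u, v} \<in># edges G}"

definition connected_mgraph :: "'a mgraph \<Rightarrow> bool" where
  "connected_mgraph G \<longleftrightarrow>
     verts G \<noteq> {} \<and> (\<forall>u \<in> verts G. \<forall>v \<in> verts G. (u, v) \<in> (adjacency G)\<^sup>*)"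

definition induced :: "'a mgraph \<Rightarrow> 'a set \<Rightarrow> 'a mgraph" where
  "induced G U = \<lparr>verts = U, edges = {#e \<in># edges G. e \<subseteq> U#}\<rparr>"

definition delete_verts :: "'a mgraph \<Rightarrow> 'a set \<Rightarrow> 'a mgraph" where
  "delete_verts G X = induced G (verts G - X)"

definition delete_edges :: "'a mgraph \<Rightarrow> 'a set multiset \<Rightarrow> 'a mgraph" where
  "delete_edges G F = \<lparr>verts = verts G, edges = edges G - F\<rparr>"

text \<open>The sets in the following two definitions are nonempty whenever \<open>G\<close> is a multigraph with
  at least one vertex, so that \<open>Inf\<close> is a minimum; both values are 0 for a single vertex.\<close>

definition vertex_connectivity :: "'a mgraph \<Rightarrow> nat" where
  "vertex_connectivity G = Inf {card X | X. X \<subseteq> verts G \<and>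
     (\<not> connected_mgraph (delete_verts G X) \<or> card (verts (delete_verts G X)) = 1)}"

definition edge_connectivity :: "'a mgraph \<Rightarrow> nat" where
  "edge_connectivity G = Inf {size F | F. F \<subseteq># edges G \<and>
     (\<not> connected_mgraph (delete_edges G F) \<or> card (verts (delete_edges G F)) = 1)}"

text \<open>The edge of the product joining \<open>(u\<^sub>1, v)\<close> and \<open>(u\<^sub>2, v)\<close> is
  \<open>{u\<^sub>1, u\<^sub>2} \<times> {v}\<close>; the multiplicities are computed in
  \<open>count_edges_cartesian_product\<close> below.\<close>

definition cartesian_product :: "'a mgraph \<Rightarrow> 'b mgraph \<Rightarrow> ('a \<times> 'b) mgraph"
    (infixl "\<box>" 70) where
  "G \<box> H = \<lparr>verts = verts G \<times> verts H,
     edges = (\<Sum>v \<in> verts H. image_mset (\<lambda>e. e \<times> {v}) (edges G)) +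
             (\<Sum>u \<in> verts G. image_mset (\<lambda>e. {u} \<times> e) (edges H))\<rparr>"

definition scramble :: "'a mgraph \<Rightarrow> 'a set set \<Rightarrow> bool" where
  "scramble G S \<longleftrightarrow> finite S \<and>
     (\<forall>egg \<in> S. egg \<subseteq> verts G \<and> egg \<noteq> {} \<and> connected_mgraph (induced G egg))"

definition hitting_set :: "'a mgraph \<Rightarrow> 'a set set \<Rightarrow> 'a set \<Rightarrow> bool" where
  "hitting_set G S C \<longleftrightarrow> C \<subseteq> verts G \<and> (\<forall>egg \<in> S. C \<inter> egg \<noteq> {})"

definition egg_cut :: "'a mgraph \<Rightarrow> 'a set set \<Rightarrow> 'a set \<Rightarrow> bool" where
  "egg_cut G S A \<longleftrightarrow> A \<subseteq> verts G \<and>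
     (\<exists>egg \<in> S. egg \<subseteq> A) \<and> (\<exists>egg \<in> S. egg \<subseteq> verts G - A)"

definition edges_between :: "'a mgraph \<Rightarrow> 'a set \<Rightarrow> 'a set \<Rightarrow> 'a set multiset" where
  "edges_between G A B = {#e \<in># edges G. \<exists>a \<in> A. \<exists>b \<in> B. e = {a, b}#}"

definition hitting_number :: "'a mgraph \<Rightarrow> 'a set set \<Rightarrow> enat" where
  "hitting_number G S = (INF C \<in> {C. hitting_set G S C}. enat (card C))"

text \<open>The infimum of the empty set is \<open>\<infinity>\<close> here.\<close>

definition egg_cut_number :: "'a mgraph \<Rightarrow> 'a set set \<Rightarrow> enat" where
  "egg_cut_number G S =
     (INF A \<in> {A. egg_cut G S A}. enat (size (edges_between G A (verts G - A))))"

definition scramble_order :: "'a mgraph \<Rightarrow> 'a set set \<Rightarrow> enat" where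
  "scramble_order G S = min (hitting_number G S) (egg_cut_number G S)"

text \<open>A multigraph has only finitely many scrambles, so this supremum is a maximum.\<close>

definition scramble_number :: "'a mgraph \<Rightarrow> enat" where
  "scramble_number G = (SUP S \<in> {S. scramble G S}. scramble_order G S)"

lemma count_image_mset_inj_eq:
  assumes "inj f"
  shows "count (image_mset f M) (f x) = count M x"
  by (induction M) (use assms in \<open>auto simp: inj_eq\<close>)

lemma count_image_mset_singleton_times:
  "count (image_mset (\<lambda>e. {u} \<times> e) M) ({u} \<times> f) = count M f"
  by (rule count_image_mset_inj_eq) (auto simp: inj_def)

lemma count_image_mset_times_singleton:
  "count (image_mset (\<lambda>e. e \<times> {v}) M) (f \<times> {v}) = count M f"
  by (rule count_image_mset_inj_eq) (auto simp: inj_def)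

lemma multigraph_cartesian_product:
  fixes G :: "'a mgraph" and H :: "'b mgraph"
  assumes "multigraph G" "multigraph H"
  shows "multigraph (G \<box> H)"
  using assms
  by (auto simp: multigraph_def cartesian_product_def set_mset_sum card_cartesian_product)

lemma count_edges_cartesian_product:
  fixes G :: "'a mgraph" and H :: "'b mgraph"
  assumes G: "multigraph G" and H: "multigraph H"
    and p: "(u\<^sub>1, v\<^sub>1) \<in> verts (G \<box> H)" and q: "(u\<^sub>2, v\<^sub>2) \<in> verts (G \<box> H)"
  shows "count (edges (G \<box> H)) {(u\<^sub>1, v\<^sub>1), (u\<^sub>2, v\<^sub>2)} =
    (if u\<^sub>1 = u\<^sub>2 then count (edges H) {v\<^sub>1, v\<^sub>2}
     else if v\<^sub>1 = v\<^sub>2 then count (edges G) {u\<^sub>1, u\<^sub>2} else 0)"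
proof -
  let ?f = "{(u\<^sub>1, v\<^sub>1), (u\<^sub>2, v\<^sub>2)}"
  have fin: "finite (verts G)" "finite (verts H)"
    using G H by (auto simp: multigraph_def)
  have mem: "u\<^sub>1 \<in> verts G" "v\<^sub>1 \<in> verts H"
    using p by (auto simp: cartesian_product_def)
  have card2: "card e = 2" if "e \<in># edges G" for e
    using G that by (auto simp: multigraph_def)
  have card2': "card e = 2" if "e \<in># edges H" for e
    using H that by (auto simp: multigraph_def)
  have Gpart: "count (image_mset (\<lambda>e. e \<times> {v}) (edges G)) ?f =
      (if v = v\<^sub>1 then if u\<^sub>1 \<noteq> u\<^sub>2 \<and> v\<^sub>1 = v\<^sub>2 then count (edges G) {u\<^sub>1, u\<^sub>2} else 0 else 0)" for v
  proof (cases "v = v\<^sub>1 \<and> v\<^sub>1 = v\<^sub>2")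
    case True
    then have "?f = {u\<^sub>1, u\<^sub>2} \<times> {v}" by auto
    then have "count (image_mset (\<lambda>e. e \<times> {v}) (edges G)) ?f = count (edges G) {u\<^sub>1, u\<^sub>2}"
      by (simp only: count_image_mset_times_singleton)
    moreover have "count (edges G) {u\<^sub>1} = 0"
      using card2[of "{u\<^sub>1}"] by (auto simp: count_eq_zero_iff)
    ultimately show ?thesis using True by auto
  next
    case False
    then have "snd ` ?f \<noteq> {v}" by auto
    moreover have "snd ` (e \<times> {v}) \<subseteq> {v}" for e :: "'a set" by auto
    ultimately have "?f \<noteq> e \<times> {v}" for e by (metis image_is_empty insert_not_empty subset_singletonD)
    then have "?f \<notin># image_mset (\<lambda>e. e \<times> {v}) (edges G)" by auto
    then show ?thesis using False by (auto simp: count_eq_zero_iff)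
  qed
  have Hpart: "count (image_mset (\<lambda>e. {u} \<times> e) (edges H)) ?f =
      (if u = u\<^sub>1 then if u\<^sub>1 = u\<^sub>2 then count (edges H) {v\<^sub>1, v\<^sub>2} else 0 else 0)" for u
  proof (cases "u = u\<^sub>1 \<and> u\<^sub>1 = u\<^sub>2")
    case True
    then have "?f = {u} \<times> {v\<^sub>1, v\<^sub>2}" by auto
    then have "count (image_mset (\<lambda>e. {u} \<times> e) (edges H)) ?f = count (edges H) {v\<^sub>1, v\<^sub>2}"
      by (simp only: count_image_mset_singleton_times)
    then show ?thesis using True by auto
  next
    case False
    then have "fst ` ?f \<noteq> {u}" by auto
    moreover have "fst ` ({u} \<times> e) \<subseteq> {u}" for e :: "'b set" by auto
    ultimately have "?f \<noteq> {u} \<times> e" for e by (metis image_is_empty insert_not_empty subset_singletonD)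
    then have "?f \<notin># image_mset (\<lambda>e. {u} \<times> e) (edges H)" by auto
    then show ?thesis using False by (auto simp: count_eq_zero_iff)
  qed
  show ?thesis
    using fin mem by (simp add: cartesian_product_def count_sum Gpart Hpart)
qed

end

theory Submission
  imports Defs
begin

text \<open>The eggs are the copies, in the fibres \<open>V(G) \<times> {v}\<close>, of the vertex sets of \<open>G\<close> whose complement
  has fewer than \<open>k\<close> elements; they are connected because \<open>\<kappa>(G) \<ge> k\<close>. A set with fewer than \<open>k\<close>
  elements in some fibre misses the egg that consists of the rest of that fibre, so the hitting
  number is at least \<open>k |V(H)|\<close>.

  Two eggs in the same fibre intersect since \<open>|V(G)| \<ge> 2k - 1\<close>, so an egg-cut \<open>A\<close> separates eggs
  in distinct fibres \<open>V(G) \<times> {v}\<close> and \<open>V(G) \<times> {w}\<close>, and then at least \<open>|V(G)| - 2k + 2\<close> of the copies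
  of \<open>H\<close> are cut. If all of them are cut, there are at least \<open>|V(G)| \<lambda>(H)\<close> edges. Otherwise some copy
  of \<open>H\<close> lies, say, in \<open>A\<close>, so that the copy of \<open>G\<close> at \<open>w\<close> is cut. If the one at \<open>v\<close> is cut as well,
  the third bound follows. If it is not, it lies in \<open>A\<close>, and at least \<open>|V(G)| - k + 1\<close> copies of \<open>H\<close>
  are cut; the resulting bound \<open>(|V(G)| - k + 1) \<lambda>(H) + \<lambda>(G)\<close> is the average of the two
  others.\<close>

section \<open>Cuts and connectivity in a multigraph\<close>

lemma verts_cartesian_product [simp]: "verts (G \<box> H) = verts G \<times> verts H"
  by (simp add: cartesian_product_def)

lemma edges_between_commute: "edges_between G A B = edges_between G B A"
proof -
  have "(\<exists>a\<in>A. \<exists>b\<in>B. e = {a, b}) = (\<exists>a\<in>B. \<exists>b\<in>A. e = {a, b})" for e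
    by (metis insert_commute)
  then show ?thesis
    by (simp add: edges_between_def)
qed

text \<open>The cut takes every parallel copy of an edge leaving \<open>U\<close>, so after its
  deletion no path leaves \<open>U\<close>. The cut is thus one of the multisets in the
  infimum.\<close>

lemma edge_connectivity_le_cut:
  assumes G: "multigraph G" and U: "U \<subseteq> verts G" "U \<noteq> {}" "U \<noteq> verts G"
  shows "edge_connectivity G \<le> size (edges_between G U (verts G - U))"
proof -
  let ?F = "edges_between G U (verts G - U)"
  let ?G' = "delete_edges G ?F"
  have step: "b \<in> U" if "(a, b) \<in> adjacency ?G'" "a \<in> U" for a b
  proof (rule ccontr)
    assume "b \<notin> U"
    have e: "{a, b} \<in># edges G - ?F"
      using that by (simp add: adjacency_def delete_edges_def)
    then have "{a, b} \<in># edges G"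
      by (rule in_diffD)
    with G have "b \<in> verts G"
      by (auto simp: multigraph_def)
    with \<open>b \<notin> U\<close> \<open>a \<in> U\<close> have "count ?F {a, b} = count (edges G) {a, b}"
      by (auto simp: edges_between_def)
    with e show False
      by (simp add: in_diff_count)
  qed
  have reach: "b \<in> U" if "(a, b) \<in> (adjacency ?G')\<^sup>*" "a \<in> U" for a b
    using that by (induction rule: rtrancl_induct) (auto dest: step)
  obtain x y where "x \<in> U" "y \<in> verts G" "y \<notin> U"
    using U by blast
  then have "(x, y) \<notin> (adjacency ?G')\<^sup>*" "x \<in> verts ?G'" "y \<in> verts ?G'"
    using reach U by (auto simp: delete_edges_def)
  then have "\<not> connected_mgraph ?G'"
    unfolding connected_mgraph_def by blast
  moreover have "?F \<subseteq># edges G"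
    by (simp add: edges_between_def)
  ultimately show ?thesis
    unfolding edge_connectivity_def by (intro cInf_lower) auto
qed

lemma connected_delete_verts:
  assumes "X \<subseteq> verts G" "card X < vertex_connectivity G"
  shows "connected_mgraph (delete_verts G X)"
proof (rule ccontr)
  assume "\<not> connected_mgraph (delete_verts G X)"
  with assms(1) have "vertex_connectivity G \<le> card X"
    unfolding vertex_connectivity_def by (intro cInf_lower) auto
  with assms(2) show False
    by simp
qed

lemma connected_fibre:
  assumes G: "multigraph G" and H: "multigraph H" and v: "v \<in> verts H"
    and W: "connected_mgraph (induced G W)"
  shows "connected_mgraph (induced (G \<box> H) (W \<times> {v}))"
proof -
  have step_fibre: "((x, v), (y, v)) \<in> adjacency (induced (G \<box> H) (W \<times> {v}))"
    if "(x, y) \<in> adjacency (induced G W)" for x y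
  proof -
    from that have "{x, y} \<in># edges G" "{x, y} \<subseteq> W"
      by (auto simp: adjacency_def induced_def)
    moreover have "{x, y} \<times> {v} = {(x, v), (y, v)}"
      by auto
    moreover have "e \<times> {v} \<in># edges (G \<box> H)" if "e \<in># edges G" for e
      using H v that by (auto simp: cartesian_product_def set_mset_sum multigraph_def)
    ultimately have "{(x, v), (y, v)} \<in># edges (G \<box> H)"
      by metis
    then show ?thesis
      using \<open>{x, y} \<subseteq> W\<close> by (auto simp: adjacency_def induced_def)
  qed
  have "((x, v), (y, v)) \<in> (adjacency (induced (G \<box> H) (W \<times> {v})))\<^sup>*"
    if "(x, y) \<in> (adjacency (induced G W))\<^sup>*" for x y
    using that
  proof (induction rule: rtrancl_induct)
    case (step y z)
    from step.IH step_fibre[OF step.hyps(2)] show ?case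
      by (rule rtrancl_into_rtrancl)
  qed simp
  with W show ?thesis
    by (auto simp: connected_mgraph_def induced_def)
qed

section \<open>Counting the edges of a cut in the product\<close>

lemma size_filter_mset_sum:
  "finite I \<Longrightarrow> size (filter_mset P (\<Sum>i\<in>I. M i)) = (\<Sum>i\<in>I. size (filter_mset P (M i)))"
  by (induction I rule: finite_induct) auto

lemma size_filter_image_mset:
  "size (filter_mset P (image_mset f M)) = size (filter_mset (\<lambda>x. P (f x)) M)"
  by (induction M) auto

text \<open>Read as a relation, \<open>A\<close> cuts the copy of \<open>G\<close> at
  \<open>v\<close> along \<open>A\<inverse>\<close>
  {v}\<open>and the copy of\<close>H\<open>at\<close>u\<open>along\<close>A \<open>{u}\<close>;
  edges of different copies are counted separately.\<close>

lemma size_cut_cartesian_product: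
  fixes G :: "'a mgraph" and H :: "'b mgraph"
  assumes G: "multigraph G" and H: "multigraph H"
    and A: "A \<subseteq> verts G \<times> verts H"
  shows "(\<Sum>v\<in>verts H. size (edges_between G (A\<inverse> `` {v}) (verts G - A\<inverse> `` {v}))) +
      (\<Sum>u\<in>verts G. size (edges_between H (A `` {u}) (verts H - A `` {u})))
    \<le> size (edges_between (G \<box> H) A (verts (G \<box> H) - A))"
proof -
  let ?P = "\<lambda>e. \<exists>a\<in>A. \<exists>b\<in>verts (G \<box> H) - A. e = {a, b}"
  have fin: "finite (verts G)" "finite (verts H)"
    using G H by (auto simp: multigraph_def)
  have 1: "size (edges_between G (A\<inverse> `` {v}) (verts G - A\<inverse> `` {v}))
      \<le> size (filter_mset ?P (image_mset (\<lambda>e. e \<times> {v}) (edges G)))" if "v \<in> verts H" for v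
    unfolding size_filter_image_mset edges_between_def
  proof (intro size_mset_mono filter_mset_mono_strong subset_mset.order_refl)
    fix e
    assume "\<exists>a\<in>A\<inverse> `` {v}. \<exists>b\<in>verts G - A\<inverse> `` {v}. e = {a, b}"
    then obtain a b where ab: "(a, v) \<in> A" "b \<in> verts G" "(b, v) \<notin> A" "e = {a, b}"
      by blast
    then have "e \<times> {v} = {(a, v), (b, v)}"
      by auto
    with ab that show "?P (e \<times> {v})"
      by (intro bexI[of _ "(a, v)"] bexI[of _ "(b, v)"]) auto
  qed
  have 2: "size (edges_between H (A `` {u}) (verts H - A `` {u}))
      \<le> size (filter_mset ?P (image_mset (\<lambda>e. {u} \<times> e) (edges H)))" if "u \<in> verts G" for u
    unfolding size_filter_image_mset edges_between_def
  proof (intro size_mset_mono filter_mset_mono_strong subset_mset.order_refl)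
    fix e
    assume "\<exists>a\<in>A `` {u}. \<exists>b\<in>verts H - A `` {u}. e = {a, b}"
    then obtain a b where ab: "(u, a) \<in> A" "b \<in> verts H" "(u, b) \<notin> A" "e = {a, b}"
      by blast
    then have "{u} \<times> e = {(u, a), (u, b)}"
      by auto
    with ab that show "?P ({u} \<times> e)"
      by (intro bexI[of _ "(u, a)"] bexI[of _ "(u, b)"]) auto
  qed
  have "edges_between (G \<box> H) A (verts (G \<box> H) - A) =
      filter_mset ?P (\<Sum>v\<in>verts H. image_mset (\<lambda>e. e \<times> {v}) (edges G)) +
      filter_mset ?P (\<Sum>u\<in>verts G. image_mset (\<lambda>e. {u} \<times> e) (edges H))"
    by (simp add: edges_between_def cartesian_product_def)
  then show ?thesis
    using fin by (simp add: size_filter_mset_sum del: verts_cartesian_product)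
      (intro add_mono sum_mono 1 2)
qed

text \<open>\<open>D\<close> and \<open>C\<close> select copies of \<open>G\<close> and
  \<open>H\<close> that meet both \<open>A\<close> and its complement; each contributes at least its
  edge connectivity. The egg-cut estimates below are instances.\<close>

lemma cut_fibres_bound:
  fixes G :: "'a mgraph" and H :: "'b mgraph"
  assumes G: "multigraph G" and H: "multigraph H" and A: "A \<subseteq> verts G \<times> verts H"
    and D: "D \<subseteq> verts H"
      "\<And>v. v \<in> D \<Longrightarrow> A\<inverse> `` {v} \<noteq> {}" "\<And>v. v \<in> D \<Longrightarrow> A\<inverse> `` {v} \<noteq> verts G"
    and C: "C \<subseteq> verts G"
      "\<And>u. u \<in> C \<Longrightarrow> A `` {u} \<noteq> {}" "\<And>u. u \<in> C \<Longrightarrow> A `` {u} \<noteq> verts H"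
  shows "card D * edge_connectivity G + card C * edge_connectivity H
    \<le> size (edges_between (G \<box> H) A (verts (G \<box> H) - A))"
proof -
  have fin: "finite (verts G)" "finite (verts H)"
    using G H by (auto simp: multigraph_def)
  have "card D * edge_connectivity G
      \<le> (\<Sum>v\<in>D. size (edges_between G (A\<inverse> `` {v}) (verts G - A\<inverse> `` {v})))"
    using A D by (intro sum_bounded_below[of D "edge_connectivity G", simplified]
        edge_connectivity_le_cut[OF G]) auto
  also have "\<dots> \<le> (\<Sum>v\<in>verts H. size (edges_between G (A\<inverse> `` {v}) (verts G - A\<inverse> `` {v})))"
    using fin D(1) by (intro sum_mono2) auto
  finally have 1: "card D * edge_connectivity G \<le> \<dots>" .
  have "card C * edge_connectivity H
      \<le> (\<Sum>u\<in>C. size (edges_between H (A `` {u}) (verts H - A `` {u})))"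
    using A C by (intro sum_bounded_below[of C "edge_connectivity H", simplified]
        edge_connectivity_le_cut[OF H]) auto
  also have "\<dots> \<le> (\<Sum>u\<in>verts G. size (edges_between H (A `` {u}) (verts H - A `` {u})))"
    using fin C(1) by (intro sum_mono2) auto
  finally have 2: "card C * edge_connectivity H \<le> \<dots>" .
  show ?thesis
    using 1 2 size_cut_cartesian_product[OF G H A] by linarith
qed

section \<open>The scramble and its hitting number\<close>

definition fibre_eggs :: "'a mgraph \<Rightarrow> 'b mgraph \<Rightarrow> nat \<Rightarrow> ('a \<times> 'b) set set" where
  "fibre_eggs G H k =
     {(verts G - X) \<times> {v} | X v. X \<subseteq> verts G \<and> card X < k \<and> v \<in> verts H}"

lemma fibre_eggsE:
  assumes "egg \<in> fibre_eggs G H k"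
  obtains X v where "egg = (verts G - X) \<times> {v}" "X \<subseteq> verts G" "card X < k" "v \<in> verts H"
  using assms by (auto simp: fibre_eggs_def)

lemma scramble_fibre_eggs:
  assumes G: "multigraph G" and H: "multigraph H" and k: "k \<le> vertex_connectivity G"
  shows "scramble (G \<box> H) (fibre_eggs G H k)"
  unfolding scramble_def
proof (intro conjI ballI)
  have "fibre_eggs G H k \<subseteq> Pow (verts G \<times> verts H)"
    by (auto simp: fibre_eggs_def)
  then show "finite (fibre_eggs G H k)"
    using G H by (auto simp: multigraph_def intro: finite_subset)
next
  fix egg
  assume "egg \<in> fibre_eggs G H k"
  then obtain X v where egg: "egg = (verts G - X) \<times> {v}" "X \<subseteq> verts G" "card X < k" "v \<in> verts H"
    by (rule fibre_eggsE)
  have conn: "connected_mgraph (induced G (verts G - X))"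
    using connected_delete_verts[of X G] egg k by (simp add: delete_verts_def)
  \<comment> \<open>Connectedness includes having a vertex.\<close>
  then show "egg \<noteq> {}"
    using egg by (auto simp: connected_mgraph_def induced_def)
  show "egg \<subseteq> verts (G \<box> H)"
    using egg by auto
  show "connected_mgraph (induced (G \<box> H) egg)"
    using connected_fibre[OF G H egg(4) conn] egg by simp
qed

lemma hitting_number_fibre_eggs:
  assumes G: "multigraph G" and H: "multigraph H"
  shows "enat (k * card (verts H)) \<le> hitting_number (G \<box> H) (fibre_eggs G H k)"
  unfolding hitting_number_def
proof (rule INF_greatest)
  fix C
  assume "C \<in> {C. hitting_set (G \<box> H) (fibre_eggs G H k) C}"
  then have C: "C \<subseteq> verts G \<times> verts H" and
    hit: "\<And>egg. egg \<in> fibre_eggs G H k \<Longrightarrow> C \<inter> egg \<noteq> {}"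
    by (auto simp: hitting_set_def)
  have fin: "finite (verts G)" "finite (verts H)"
    using G H by (auto simp: multigraph_def)
  have k: "k \<le> card (C\<inverse> `` {v})" if v: "v \<in> verts H" for v
  proof (rule ccontr)
    assume "\<not> k \<le> card (C\<inverse> `` {v})"
    then have "(verts G - C\<inverse> `` {v}) \<times> {v} \<in> fibre_eggs G H k"
      using C v by (auto simp: fibre_eggs_def intro!: exI[of _ "C\<inverse> `` {v}"])
    from hit[OF this] show False
      by auto
  qed
  \<comment> \<open>\<open>C\<close> is counted slice by slice, over disjoint fibres.\<close>
  have "k * card (verts H) \<le> (\<Sum>v\<in>verts H. card (C\<inverse> `` {v}))"
    using sum_bounded_below[of "verts H" k, OF k] by (simp add: mult.commute)
  also have "\<dots> = card (Sigma (verts H) (\<lambda>v. C\<inverse> `` {v}))"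
    using fin C by (intro card_SigmaI[symmetric]) (auto intro: finite_subset[of _ "verts G"])
  also have "Sigma (verts H) (\<lambda>v. C\<inverse> `` {v}) = C\<inverse>"
    using C by auto
  finally show "enat (k * card (verts H)) \<le> enat (card C)"
    by simp
qed

section \<open>Size of an egg-cut\<close>

text \<open>This is the case of a copy of \<open>H\<close> inside \<open>A\<close>: every fibre then
  meets \<open>A\<close>, so a fibre is cut as soon as it is not contained in
  \<open>A\<close>.\<close>

lemma fibre_eggs_cut_aux:
  fixes G :: "'a mgraph" and H :: "'b mgraph"
  assumes G: "multigraph G" and H: "multigraph H" and A: "A \<subseteq> verts G \<times> verts H"
    and n: "card (verts G) \<ge> 2 * k - 1"
    and X: "X \<subseteq> verts G" "card X < k" "v \<in> verts H" "(verts G - X) \<times> {v} \<subseteq> A"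
    and Y: "Y \<subseteq> verts G" "card Y < k" "w \<in> verts H" "(verts G - Y) \<times> {w} \<inter> A = {}"
    and u: "u \<in> verts G" "{u} \<times> verts H \<subseteq> A"
  shows "min (card (verts G) * edge_connectivity H)
      ((card (verts G) + 2 - 2 * k) * edge_connectivity H + 2 * edge_connectivity G)
    \<le> size (edges_between (G \<box> H) A (verts (G \<box> H) - A))" (is "_ \<le> ?s")
proof -
  let ?L = "edge_connectivity H" and ?l = "edge_connectivity G"
  have finG: "finite (verts G)"
    using G by (simp add: multigraph_def)
  have finXY: "finite X" "finite Y"
    using X(1) Y(1) finG by (auto intro: finite_subset)
  \<comment> \<open>With \<open>j = k - 1\<close> and the excess \<open>r\<close> over
    \<open>2 * k - 1\<close>, truncated subtractions become sums: the factor
    \<open>card (verts G) + 2 - 2 * k\<close> is \<open>1 + r\<close>.\<close>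
  obtain j where k: "k = Suc j"
    using X(2) by (cases k) auto
  define r where "r = card (verts G) - (2 * k - 1)"
  have n': "card (verts G) = 2 * j + 1 + r"
    using n by (simp add: r_def k)
  have nY: "card (verts G - Y) \<ge> j + 1 + r"
    using Y(2) by (simp add: card_Diff_subset finXY Y(1) n' k)
  then have "verts G - Y \<noteq> {}"
    by (intro notI) simp
  then have w: "A\<inverse> `` {w} \<noteq> {}" "A\<inverse> `` {w} \<noteq> verts G"
    using u Y(3,4) by auto
  show ?thesis
  proof (cases "verts G \<times> {v} \<subseteq> A")
    case True
    \<comment> \<open>For \<open>x\<close> outside \<open>Y\<close>, \<open>(x, v)\<close> lies in
      \<open>A\<close> and \<open>(x, w)\<close> does not, so the copy of \<open>H\<close> at
      \<open>x\<close> is cut.\<close>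
    then have "card {w} * ?l + card (verts G - Y) * ?L \<le> ?s"
      using X(3) Y w by (intro cut_fibres_bound[OF G H A]) auto
    moreover have "(j + 1 + r) * ?L \<le> card (verts G - Y) * ?L"
      using nY by (rule mult_le_mono1)
    ultimately have s: "?l + (j + 1 + r) * ?L \<le> ?s"
      by simp
    show ?thesis
    \<comment> \<open>The smaller of \<open>j * ?L\<close> and \<open>?l\<close> may replace the
      larger: this yields \<open>(2 * j + 1 + r) * ?L\<close> in one case and
      \<open>2 * ?l + (1 + r) * ?L\<close> in the other.\<close>
    proof (cases "j * ?L \<le> ?l")
      case True
      have "card (verts G) * ?L = j * ?L + (j + 1 + r) * ?L"
        by (simp add: n' algebra_simps)
      with True s show ?thesis
        by linarith
    next
      case False
      have "(j + 1 + r) * ?L = j * ?L + (card (verts G) + 2 - 2 * k) * ?L"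
        by (simp add: n' k algebra_simps)
      with False s show ?thesis
        by linarith
    qed
  next
    case False
    then have v: "A\<inverse> `` {v} \<noteq> {}" "A\<inverse> `` {v} \<noteq> verts G"
      using u X(3) by auto
    have "card (X \<union> Y) \<le> 2 * j"
      using card_Un_le[of X Y] X(2) Y(2) by (simp add: k)
    then have nXY: "card (verts G - (X \<union> Y)) \<ge> 1 + r"
      using card_Diff_subset[of "X \<union> Y" "verts G"] finXY X(1) Y(1) by (simp add: n')
    then have "verts G - (X \<union> Y) \<noteq> {}"
      by (intro notI) simp
    \<comment> \<open>For \<open>v = w\<close>, a vertex outside both \<open>X\<close> and
      \<open>Y\<close> would give a point both in \<open>A\<close> and outside it. Hence
      \<open>{v, w}\<close> counts two cut copies of \<open>G\<close>.\<close>
    then have "v \<noteq> w"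
      using X(4) Y(4) by auto
    moreover have "card {v, w} * ?l + card (verts G - (X \<union> Y)) * ?L \<le> ?s"
      using X Y w v by (intro cut_fibres_bound[OF G H A]) auto
    moreover have "(1 + r) * ?L \<le> card (verts G - (X \<union> Y)) * ?L"
      using nXY by (rule mult_le_mono1)
    moreover have "card (verts G) + 2 - 2 * k = 1 + r"
      by (simp add: n' k)
    ultimately show ?thesis
      by simp
  qed
qed

lemma egg_cut_number_fibre_eggs:
  fixes G :: "'a mgraph" and H :: "'b mgraph"
  assumes G: "multigraph G" and H: "multigraph H"
    and n: "card (verts G) \<ge> 2 * k - 1"
  shows "enat (min (card (verts G) * edge_connectivity H)
      ((card (verts G) + 2 - 2 * k) * edge_connectivity H + 2 * edge_connectivity G))
    \<le> egg_cut_number (G \<box> H) (fibre_eggs G H k)" (is "enat ?m \<le> _")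
  unfolding egg_cut_number_def
proof (rule INF_greatest)
  fix A
  assume "A \<in> {A. egg_cut (G \<box> H) (fibre_eggs G H k) A}"
  then obtain egg egg' where A: "A \<subseteq> verts G \<times> verts H"
    and egg: "egg \<in> fibre_eggs G H k" "egg \<subseteq> A"
    and egg': "egg' \<in> fibre_eggs G H k" "egg' \<subseteq> verts G \<times> verts H - A"
    by (auto simp: egg_cut_def)
  let ?B = "verts G \<times> verts H - A"
  obtain X v where X: "X \<subseteq> verts G" "card X < k" "v \<in> verts H" "(verts G - X) \<times> {v} \<subseteq> A"
    using egg by (auto elim!: fibre_eggsE)
  obtain Y w where Y: "Y \<subseteq> verts G" "card Y < k" "w \<in> verts H" "(verts G - Y) \<times> {w} \<subseteq> ?B"
    using egg' by (auto elim!: fibre_eggsE)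
  \<comment> \<open>A cut has the same size seen from either side, so a copy of \<open>H\<close>
    missing \<open>A\<close> is treated by passing to \<open>?B\<close>, with \<open>X\<close> and
    \<open>Y\<close> exchanged.\<close>
  have swap: "size (edges_between (G \<box> H) ?B (verts (G \<box> H) - ?B)) =
      size (edges_between (G \<box> H) A (verts (G \<box> H) - A))"
    using A edges_between_commute[of "G \<box> H" ?B A] by (simp add: double_diff)
  consider "\<And>u. u \<in> verts G \<Longrightarrow> A `` {u} \<noteq> {} \<and> A `` {u} \<noteq> verts H"
    | u where "u \<in> verts G" "A `` {u} = verts H" | u where "u \<in> verts G" "A `` {u} = {}"
    by blast
  then have "?m \<le> size (edges_between (G \<box> H) A (verts (G \<box> H) - A))"
  proof cases
    case 1
    \<comment> \<open>All copies of \<open>H\<close> are cut, and they alone give the first term of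
      the minimum.\<close>
    then show ?thesis
      using cut_fibres_bound[OF G H A, of "{}" "verts G"] by simp
  next
    case (2 u)
    then have "{u} \<times> verts H \<subseteq> A"
      by auto
    with 2 Y show ?thesis
      by (intro fibre_eggs_cut_aux[OF G H A n X, where Y = Y and w = w and u = u]) auto
  next
    case (3 u)
    then have "{u} \<times> verts H \<subseteq> ?B"
      by auto
    with 3 X show ?thesis
      unfolding swap[symmetric]
      by (intro fibre_eggs_cut_aux[OF G H _ n Y, where Y = X and w = v and u = u]) auto
  qed
  then show "enat ?m \<le> enat (size (edges_between (G \<box> H) A (verts (G \<box> H) - A)))"
    by simp
qed

theorem theorem4p1:
  fixes G :: "'a mgraph" and H :: "'b mgraph" and k :: nat
  assumes "multigraph G" and "multigraph H"
    and "connected_mgraph G" and "connected_mgraph H"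
    and "k \<ge> 1"
    and "vertex_connectivity G \<ge> k"
    and "card (verts G) \<ge> 2 * k - 1"
  shows "scramble_number (G \<box> H) \<ge>
    enat (Min {k * card (verts H),
               card (verts G) * edge_connectivity H,
               (card (verts G) + 2 - 2 * k) * edge_connectivity H + 2 * edge_connectivity G})"
proof -
  let ?S = "fibre_eggs G H k"
  let ?m = "min (card (verts G) * edge_connectivity H)
      ((card (verts G) + 2 - 2 * k) * edge_connectivity H + 2 * edge_connectivity G)"
  have "enat (min (k * card (verts H)) ?m) \<le> scramble_order (G \<box> H) ?S"
    using hitting_number_fibre_eggs[OF assms(1,2), of k]
      egg_cut_number_fibre_eggs[OF assms(1,2,7)]
    unfolding scramble_order_def by (meson enat_ord_simps(1) min.bounded_iff min.cobounded1
        min.cobounded2 order_trans)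
  \<comment> \<open>The supremum is at least the order of this one scramble.\<close>
  also have "\<dots> \<le> scramble_number (G \<box> H)"
    unfolding scramble_number_def
    using scramble_fibre_eggs[OF assms(1,2,6)] by (intro SUP_upper) simp
  finally show ?thesis
    by simp
qed

end
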